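(* Let $a<b$ be real numbers, let $f:[a,b]\to\mathbb{R}$ be (locally) Lebesgue integrable, and let $0\le r<\infty$. Then $\|f\|_{D,\lambda}\le r$ if and only if there exist non-decreasing, locally absolutely continuous functions $h_1,h_2:[a,b]\to\mathbb{R}$ such that $\|h_2-h_1\|_\infty\le r/2$ and $f=\dot h_2-\dot h_1$ almost everywhere on $[a,b]$.
   Context: $\lambda$ is Lebesgue measure. For a locally integrable $f$ on a real interval $X$, the discrepancy is $\|f\|_{D,\lambda}:=\sup_{[c,d]\subseteq X}\left|\int_c^d f\,d\lambda\right|$. The uniform norm is $\|h\|_\infty=\sup_{x\in X}|h(x)|$, and $\dot h$ denotes the (almost everywhere defined) derivative of $h$. *)

theory Defs
  imports "HOL-Analysis.Analysis"
begin

text \<open>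
  Functions on a real interval \<open>X\<close> are total functions of type \<open>real \<Rightarrow> real\<close>; no definition
  below depends on values outside \<open>X\<close>.
\<close>

definition locally_integrable_on :: "(real \<Rightarrow> real) \<Rightarrow> real set \<Rightarrow> bool"  (infixr "locally'_integrable'_on" 46)
  where "f locally_integrable_on X \<longleftrightarrow>
    (\<forall>c d. {c..d} \<subseteq> X \<longrightarrow> f absolutely_integrable_on {c..d})"

text \<open>
  The two norms take values in \<^typ>\<open>ennreal\<close>, so that the suprema are the true ones even
  for unbounded families.
\<close>

definition discrepancy_norm :: "real set \<Rightarrow> (real \<Rightarrow> real) \<Rightarrow> ennreal"
  where "discrepancy_norm X f =
    (SUP (c, d) \<in> {(c, d). c \<le> d \<and> {c..d} \<subseteq> X}.
      ennreal \<bar>LINT x:{c..d}|lebesgue. f x\<bar>)"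

definition uniform_norm :: "real set \<Rightarrow> (real \<Rightarrow> real) \<Rightarrow> ennreal"
  where "uniform_norm X h = (SUP x \<in> X. ennreal \<bar>h x\<bar>)"

text \<open>
  Absolute continuity of a function on an interval; not to be confused with the library's
  \<^const>\<open>absolutely_continuous\<close>, a relation between measures.
\<close>

definition absolutely_continuous_on :: "real set \<Rightarrow> (real \<Rightarrow> real) \<Rightarrow> bool"
  where "absolutely_continuous_on X h \<longleftrightarrow>
    (\<forall>\<epsilon>>0. \<exists>\<delta>>0. \<forall>(n::nat) (u::nat \<Rightarrow> real) (v::nat \<Rightarrow> real).
      (\<forall>i<n. u i \<le> v i \<and> {u i..v i} \<subseteq> X) \<and>
      disjoint_family_on (\<lambda>i. {u i<..<v i}) {..<n} \<and>
      (\<Sum>i<n. v i - u i) < \<delta>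
      \<longrightarrow> (\<Sum>i<n. \<bar>h (v i) - h (u i)\<bar>) < \<epsilon>)"

definition locally_absolutely_continuous_on :: "real set \<Rightarrow> (real \<Rightarrow> real) \<Rightarrow> bool"
  where "locally_absolutely_continuous_on X h \<longleftrightarrow>
    (\<forall>c d. {c..d} \<subseteq> X \<longrightarrow> absolutely_continuous_on {c..d} h)"

end

theory Submission
  imports Defs
begin

text \<open>
  Let \<open>F x = \<integral>\<^sub>a\<^sup>x f\<close>. The discrepancy bound says that \<open>F\<close> oscillates by at most \<open>r\<close>, so a constant
  shift \<open>F + c\<close> is bounded by \<open>r / 2\<close>; take for \<open>h1\<close> and \<open>h2\<close> the indefinite integrals of the
  negative and positive parts of \<open>f\<close>, the latter shifted by \<open>c\<close>. Conversely, \<open>h = h2 - h1\<close> is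
  absolutely continuous with derivative \<open>f\<close> almost everywhere, so \<open>\<integral>\<^sub>c\<^sup>d f = h d - h c\<close>.
\<close>

section \<open>Absolute continuity: finite families of intervals and closure properties\<close>

text \<open>An enumeration of \<open>I\<close> by \<open>{..<card I}\<close> transports the defining
  condition to any finite index set. The index type is left free so that a family can be indexed
  directly by the tagged intervals of a division.\<close>

lemma absolutely_continuous_onD:
  assumes "absolutely_continuous_on X h" "\<epsilon> > 0"
  obtains \<delta> where "\<delta> > 0"
    "\<forall>(I :: 'i set) u v. finite I \<and> (\<forall>i\<in>I. u i \<le> v i \<and> {u i..v i} \<subseteq> X) \<and>
      disjoint_family_on (\<lambda>i. {u i<..<v i}) I \<and> (\<Sum>i\<in>I. v i - u i) < \<delta> \<longrightarrow>
      (\<Sum>i\<in>I. \<bar>h (v i) - h (u i)\<bar>) < \<epsilon>"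
proof -
  obtain \<delta> where \<delta>: "\<delta> > 0"
    "\<forall>(n::nat) u v. (\<forall>i<n. u i \<le> v i \<and> {u i..v i} \<subseteq> X) \<and>
      disjoint_family_on (\<lambda>i. {u i<..<v i}) {..<n} \<and> (\<Sum>i<n. v i - u i) < \<delta> \<longrightarrow>
      (\<Sum>i<n. \<bar>h (v i) - h (u i)\<bar>) < \<epsilon>"
    using assms(1)[unfolded absolutely_continuous_on_def, THEN spec, THEN mp, OF assms(2)]
    by (elim exE conjE) (rule that)
  show thesis
  proof
    show "\<forall>(I :: 'i set) u v. finite I \<and> (\<forall>i\<in>I. u i \<le> v i \<and> {u i..v i} \<subseteq> X) \<and>
      disjoint_family_on (\<lambda>i. {u i<..<v i}) I \<and> (\<Sum>i\<in>I. v i - u i) < \<delta> \<longrightarrow>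
      (\<Sum>i\<in>I. \<bar>h (v i) - h (u i)\<bar>) < \<epsilon>"
    proof (intro allI impI, elim conjE)
      fix I :: "'i set" and u v
      assume I: "finite I" "\<forall>i\<in>I. u i \<le> v i \<and> {u i..v i} \<subseteq> X"
        "disjoint_family_on (\<lambda>i. {u i<..<v i}) I" "(\<Sum>i\<in>I. v i - u i) < \<delta>"
      obtain e where e: "bij_betw e {..<card I} I"
        using ex_bij_betw_nat_finite[OF I(1)] by (auto simp: atLeast0LessThan)
      have "(\<Sum>i<card I. \<bar>h (v (e i)) - h (u (e i))\<bar>) < \<epsilon>"
      proof (rule \<delta>(2)[rule_format], intro conjI)
        show "\<forall>i<card I. u (e i) \<le> v (e i) \<and> {u (e i)..v (e i)} \<subseteq> X"
          using I(2) bij_betwE[OF e] by blast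
        show "disjoint_family_on (\<lambda>i. {u (e i)<..<v (e i)}) {..<card I}"
          using I(3) e by (simp add: disjoint_family_on_def bij_betw_def inj_on_def image_iff) blast
        show "(\<Sum>i<card I. v (e i) - u (e i)) < \<delta>"
          using I(4) sum.reindex_bij_betw[OF e, of "\<lambda>i. v i - u i"] by simp
      qed
      then show "(\<Sum>i\<in>I. \<bar>h (v i) - h (u i)\<bar>) < \<epsilon>"
        using sum.reindex_bij_betw[OF e, of "\<lambda>i. \<bar>h (v i) - h (u i)\<bar>"] by simp
    qed
  qed (fact \<delta>(1))
qed

lemma absolutely_continuous_on_diff:
  assumes "absolutely_continuous_on X g" "absolutely_continuous_on X h"
  shows "absolutely_continuous_on X (\<lambda>x. g x - h x)"
  unfolding absolutely_continuous_on_def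
proof (intro allI impI)
  fix \<epsilon> :: real assume "\<epsilon> > 0"
  then have e2: "\<epsilon> / 2 > 0" by simp
  obtain d1 where d1: "d1 > 0"
    "\<forall>(I :: nat set) u v. finite I \<and> (\<forall>i\<in>I. u i \<le> v i \<and> {u i..v i} \<subseteq> X) \<and>
      disjoint_family_on (\<lambda>i. {u i<..<v i}) I \<and> (\<Sum>i\<in>I. v i - u i) < d1 \<longrightarrow>
      (\<Sum>i\<in>I. \<bar>g (v i) - g (u i)\<bar>) < \<epsilon> / 2"
    by (rule absolutely_continuous_onD[OF assms(1) e2])
  obtain d2 where d2: "d2 > 0"
    "\<forall>(I :: nat set) u v. finite I \<and> (\<forall>i\<in>I. u i \<le> v i \<and> {u i..v i} \<subseteq> X) \<and>
      disjoint_family_on (\<lambda>i. {u i<..<v i}) I \<and> (\<Sum>i\<in>I. v i - u i) < d2 \<longrightarrow>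
      (\<Sum>i\<in>I. \<bar>h (v i) - h (u i)\<bar>) < \<epsilon> / 2"
    by (rule absolutely_continuous_onD[OF assms(2) e2])
  show "\<exists>\<delta>>0. \<forall>(n::nat) u v. (\<forall>i<n. u i \<le> v i \<and> {u i..v i} \<subseteq> X) \<and>
      disjoint_family_on (\<lambda>i. {u i<..<v i}) {..<n} \<and> (\<Sum>i<n. v i - u i) < \<delta> \<longrightarrow>
      (\<Sum>i<n. \<bar>g (v i) - h (v i) - (g (u i) - h (u i))\<bar>) < \<epsilon>"
  proof (intro exI[of _ "min d1 d2"] conjI allI impI)
    fix n :: nat and u v
    assume *: "(\<forall>i<n. u i \<le> v i \<and> {u i..v i} \<subseteq> X) \<and>
      disjoint_family_on (\<lambda>i. {u i<..<v i}) {..<n} \<and> (\<Sum>i<n. v i - u i) < min d1 d2"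
    have "(\<Sum>i<n. \<bar>g (v i) - h (v i) - (g (u i) - h (u i))\<bar>)
        \<le> (\<Sum>i<n. \<bar>g (v i) - g (u i)\<bar> + \<bar>h (v i) - h (u i)\<bar>)"
      by (intro sum_mono) linarith
    also have "\<dots> < \<epsilon> / 2 + \<epsilon> / 2"
      unfolding sum.distrib using * by (intro add_strict_mono d1(2)[rule_format] d2(2)[rule_format]) auto
    finally show "(\<Sum>i<n. \<bar>g (v i) - h (v i) - (g (u i) - h (u i))\<bar>) < \<epsilon>" by simp
  qed (use d1 d2 in auto)
qed

lemma absolutely_continuous_on_add_const_iff:
  "absolutely_continuous_on X (\<lambda>x. h x + c) \<longleftrightarrow> absolutely_continuous_on X h"
  by (simp add: absolutely_continuous_on_def)

lemma absolutely_continuous_on_subset: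
  assumes "absolutely_continuous_on X h" "Y \<subseteq> X"
  shows "absolutely_continuous_on Y h"
  unfolding absolutely_continuous_on_def
proof (intro allI impI)
  fix \<epsilon> :: real assume "\<epsilon> > 0"
  obtain \<delta> where \<delta>: "\<delta> > 0"
    "\<forall>(I :: nat set) u v. finite I \<and> (\<forall>i\<in>I. u i \<le> v i \<and> {u i..v i} \<subseteq> X) \<and>
      disjoint_family_on (\<lambda>i. {u i<..<v i}) I \<and> (\<Sum>i\<in>I. v i - u i) < \<delta> \<longrightarrow>
      (\<Sum>i\<in>I. \<bar>h (v i) - h (u i)\<bar>) < \<epsilon>"
    by (rule absolutely_continuous_onD[OF assms(1) \<open>\<epsilon> > 0\<close>])
  show "\<exists>\<delta>>0. \<forall>(n::nat) u v. (\<forall>i<n. u i \<le> v i \<and> {u i..v i} \<subseteq> Y) \<and>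
      disjoint_family_on (\<lambda>i. {u i<..<v i}) {..<n} \<and> (\<Sum>i<n. v i - u i) < \<delta> \<longrightarrow>
      (\<Sum>i<n. \<bar>h (v i) - h (u i)\<bar>) < \<epsilon>"
    using assms(2) by (intro exI[of _ \<delta>] conjI allI impI \<delta>(1) \<delta>(2)[rule_format]) auto
qed

section \<open>Integrals and lengths over non-overlapping intervals\<close>

text \<open>Closed intervals with disjoint interiors meet only in endpoints, hence in a negligible
  set, so their integrals add up to the integral over the union. Since \<open>g\<close> is
  nonnegative, enlarging the union to \<open>S\<close> can only increase the integral.\<close>

lemma sum_integral_disjoint_intervals_le:
  fixes g :: "real \<Rightarrow> real"
  assumes "finite I" and le: "\<And>i. i \<in> I \<Longrightarrow> u i \<le> v i \<and> {u i..v i} \<subseteq> S"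
    and disj: "disjoint_family_on (\<lambda>i. {u i<..<v i}) I"
    and int: "\<And>i. i \<in> I \<Longrightarrow> g integrable_on {u i..v i}"
    and g: "g integrable_on S" "\<And>x. x \<in> S \<Longrightarrow> 0 \<le> g x"
  shows "(\<Sum>i\<in>I. integral {u i..v i} g) \<le> integral S g"
proof -
  have "(g has_integral (\<Sum>i\<in>I. integral {u i..v i} g)) (\<Union>i\<in>I. {u i..v i})"
  proof (intro has_integral_UN pairwiseI integrable_integral int)
    fix i j assume ij: "i \<in> I" "j \<in> I" "i \<noteq> j"
    have "{u i..v i} \<inter> {u j..v j} \<subseteq> {u i, v i, u j, v j}"
    proof
      fix x assume x: "x \<in> {u i..v i} \<inter> {u j..v j}"
      have "{u i<..<v i} \<inter> {u j<..<v j} = {}"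
        using disj ij by (auto simp: disjoint_family_on_def)
      then have "\<not> (x \<in> {u i<..<v i} \<and> x \<in> {u j<..<v j})" by blast
      with x show "x \<in> {u i, v i, u j, v j}" by auto
    qed
    then show "negligible ({u i..v i} \<inter> {u j..v j})"
      by (rule negligible_subset[rotated]) (simp add: negligible_finite)
  qed (fact \<open>finite I\<close>)
  moreover have "(\<Union>i\<in>I. {u i..v i}) \<subseteq> S" using le by blast
  ultimately show ?thesis
    using has_integral_subset_le integrable_integral[OF g(1)] g(2) by blast
qed

text \<open>The case \<open>g = 1\<close> of the preceding bound. It turns smallness of an open set
  around the exceptional points into smallness of the total length required by absolute
  continuity.\<close>

lemma sum_length_disjoint_intervals_le:
  fixes u v :: "'i \<Rightarrow> real"
  assumes "finite I" and le: "\<And>i. i \<in> I \<Longrightarrow> u i \<le> v i \<and> {u i..v i} \<subseteq> S"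
    and "disjoint_family_on (\<lambda>i. {u i<..<v i}) I" and "S \<in> lmeasurable"
  shows "(\<Sum>i\<in>I. v i - u i) \<le> measure lebesgue S"
proof -
  have "(\<Sum>i\<in>I. v i - u i) = (\<Sum>i\<in>I. integral {u i..v i} (\<lambda>x. 1::real))"
    using le by (intro sum.cong) auto
  also have "\<dots> \<le> integral S (\<lambda>x. 1)"
    using assms by (intro sum_integral_disjoint_intervals_le) (auto intro: integrable_on_const)
  finally show ?thesis by (simp add: lmeasure_integral assms)
qed

section \<open>Fundamental theorem of calculus for absolutely continuous functions\<close>

text \<open>
  In the Riemann sums of a fine tagged division, the intervals with tag outside \<open>N\<close> are controlled by
  the derivative; those with tag in \<open>N\<close> lie in an open set of small measure, so absolute
  continuity bounds the increments of \<open>h\<close> over them.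
\<close>

lemma fundamental_theorem_of_calculus_absolutely_continuous:
  fixes h :: "real \<Rightarrow> real"
  assumes "a \<le> b" and ac: "absolutely_continuous_on {a..b} h" and "negligible N"
    and der: "\<And>x. x \<in> {a..b} - N \<Longrightarrow> (h has_real_derivative f x) (at x within {a..b})"
  shows "(f has_integral h b - h a) {a..b}"
proof -
  \<comment> \<open>With the integrand set to 0 on \<open>N\<close>, an interval tagged in
    \<open>N\<close> adds nothing to the Riemann sum, so its error is just the increment of
    \<open>h\<close>.\<close>
  define g where "g x = (if x \<in> N then 0 else f x)" for x
  have "(g has_integral h b - h a) {a..b}"
    unfolding has_integral_real
  proof (intro allI impI)
    fix e :: real assume "e > 0"
    \<comment> \<open>The summand 1 keeps the denominator positive when \<open>a = b\<close> and
      makes the bound on \<open>\<epsilon> * (b - a)\<close> strict.\<close>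
    define \<epsilon> where "\<epsilon> = e / (2 * (b - a + 1))"
    have \<epsilon>: "\<epsilon> > 0" "\<epsilon> * (b - a) < e / 2"
      using \<open>e > 0\<close> \<open>a \<le> b\<close> by (simp_all add: \<epsilon>_def field_simps)
    have "\<exists>d>0. \<forall>y\<in>{a..b}. \<bar>y - x\<bar> < d \<longrightarrow> \<bar>h y - h x - f x * (y - x)\<bar> \<le> \<epsilon> * \<bar>y - x\<bar>"
      if "x \<in> {a..b} - N" for x
      using der[OF that] \<epsilon>(1) unfolding has_field_derivative_def has_derivative_within_alt by auto
    then obtain d where d: "\<And>x. x \<in> {a..b} - N \<Longrightarrow> d x > 0"
      "\<And>x y. \<lbrakk>x \<in> {a..b} - N; y \<in> {a..b}; \<bar>y - x\<bar> < d x\<rbrakk>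
        \<Longrightarrow> \<bar>h y - h x - f x * (y - x)\<bar> \<le> \<epsilon> * \<bar>y - x\<bar>"
      by metis
    obtain \<delta> where \<delta>: "\<delta> > 0"
      "\<forall>(I :: (real \<times> real set) set) u v. finite I \<and> (\<forall>i\<in>I. u i \<le> v i \<and> {u i..v i} \<subseteq> {a..b}) \<and>
        disjoint_family_on (\<lambda>i. {u i<..<v i}) I \<and> (\<Sum>i\<in>I. v i - u i) < \<delta> \<longrightarrow>
        (\<Sum>i\<in>I. \<bar>h (v i) - h (u i)\<bar>) < e / 2"
      by (rule absolutely_continuous_onD[OF ac half_gt_zero[OF \<open>e > 0\<close>]])
    obtain U where U: "open U" "N \<subseteq> U" "U - N \<in> lmeasurable" "emeasure lebesgue (U - N) < ennreal \<delta>"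
      using sets_lebesgue_outer_open[OF negligible_imp_sets[OF \<open>negligible N\<close>] \<open>\<delta> > 0\<close>] .
    \<comment> \<open>The outer approximation bounds only the measure of \<open>U - N\<close>; the
      set displayed is its symmetric difference with \<open>U\<close>, contained in
      \<open>N\<close>, so \<open>U\<close> has the same measure.\<close>
    have "negligible ((U - N) - U \<union> (U - (U - N)))"
      by (rule negligible_subset[OF \<open>negligible N\<close>]) auto
    note lmeasurable_negligible_symdiff[OF U(3) this] measure_negligible_symdiff[OF U(3) this]
    moreover have "measure lebesgue (U - N) < \<delta>"
      using U(3,4) \<open>\<delta> > 0\<close> by (simp add: emeasure_eq_measure2 ennreal_less_iff)
    ultimately have U': "U \<in> lmeasurable" "measure lebesgue U < \<delta>" by simp_all
    \<comment> \<open>The first two cases confine an interval to \<open>U\<close> or to the range of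
      the linear approximation at its tag. The last only makes \<open>\<gamma>\<close> a gauge on
      the whole line.\<close>
    define \<gamma> where "\<gamma> x = (if x \<in> N then U else if x \<in> {a..b} then ball x (d x) else ball x 1)" for x
    have gauge: "gauge \<gamma>"
      using U d(1) by (auto simp: gauge_def \<gamma>_def)
    have estimate: "norm ((\<Sum>(x,K)\<in>D. measure lborel K *\<^sub>R g x) - (h b - h a)) < e"
      if D: "D tagged_division_of {a..b}" "\<gamma> fine D" for D
    proof -
      note tD = tagged_division_ofD[OF D(1)]
      have K: "\<exists>u v. u \<le> v \<and> K = {u..v}" if xK: "(x, K) \<in> D" for x K
      proof -
        obtain u v where "K = {u..v}" using tD(4)[OF xK] by auto
        moreover have "u \<le> v" using tD(2)[OF xK] calculation by auto
        ultimately show ?thesis by blast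
      qed
      have int: "interior K = {Inf K<..<Sup K}" if "(x, K) \<in> D" for x K
        using K[OF that] by auto
      define E where "E = {p \<in> D. fst p \<in> N}"
      \<comment> \<open>The contribution of one tagged interval to the total error: the increments
        of \<open>h\<close> telescope to \<open>h b - h a\<close> over the whole division.\<close>
      define err where "err = (\<lambda>(x,K). measure lborel K * g x - (h (Sup K) - h (Inf K)))"
      have fin: "finite D" "finite E" using tD(1) by (auto simp: E_def)
      have "(\<Sum>p\<in>E. \<bar>h (Sup (snd p)) - h (Inf (snd p))\<bar>) < e / 2"
      proof (rule \<delta>(2)[rule_format], intro conjI)
        have sub: "Inf (snd p) \<le> Sup (snd p) \<and> {Inf (snd p)..Sup (snd p)} \<subseteq> {a..b}" if "p \<in> E" for p
        proof -
          obtain x L where p: "p = (x, L)" by (cases p)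
          with that have "(x, L) \<in> D" by (simp add: E_def)
          from K[OF this] tD(3)[OF this] show ?thesis by (auto simp: p)
        qed
        then show "\<forall>p\<in>E. Inf (snd p) \<le> Sup (snd p) \<and> {Inf (snd p)..Sup (snd p)} \<subseteq> {a..b}" by blast
        show disj: "disjoint_family_on (\<lambda>p. {Inf (snd p)<..<Sup (snd p)}) E"
          unfolding disjoint_family_on_def
        proof (intro ballI impI)
          fix p q assume pq: "p \<in> E" "q \<in> E" "p \<noteq> q"
          obtain x K y L where p: "p = (x, K)" "q = (y, L)" by (cases p, cases q) auto
          have "interior K \<inter> interior L = {}"
            using tD(5)[of x K y L] pq unfolding p E_def by auto
          moreover have "interior K = {Inf K<..<Sup K}" "interior L = {Inf L<..<Sup L}"
            using int[of x K] int[of y L] pq unfolding p E_def by simp_all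
          ultimately show "{Inf (snd p)<..<Sup (snd p)} \<inter> {Inf (snd q)<..<Sup (snd q)} = {}"
            by (simp add: p)
        qed
        have "{Inf (snd p)..Sup (snd p)} \<subseteq> U" if "p \<in> E" for p
        proof -
          obtain x L where p: "p = (x, L)" by (cases p)
          with that have xL: "(x, L) \<in> D" "x \<in> N" by (simp_all add: E_def)
          then have "L \<subseteq> U" using fineD[OF D(2) xL(1)] by (simp add: \<gamma>_def)
          with K[OF xL(1)] show ?thesis by (auto simp: p)
        qed
        then have "(\<Sum>p\<in>E. Sup (snd p) - Inf (snd p)) \<le> measure lebesgue U"
          using sub by (intro sum_length_disjoint_intervals_le fin disj U') auto
        then show "(\<Sum>p\<in>E. Sup (snd p) - Inf (snd p)) < \<delta>" using U' by linarith
      qed (rule fin)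
      moreover have "(\<Sum>p\<in>E. \<bar>err p\<bar>) = (\<Sum>p\<in>E. \<bar>h (Sup (snd p)) - h (Inf (snd p))\<bar>)"
        by (intro sum.cong) (auto simp: E_def err_def g_def)
      moreover have "(\<Sum>p\<in>D - E. \<bar>err p\<bar>) \<le> \<epsilon> * (b - a)"
      proof -
        have "\<bar>err p\<bar> \<le> \<epsilon> * measure lborel (snd p)" if "p \<in> D - E" for p
        proof -
          obtain x K where p: "p = (x, K)" by (cases p)
          have xK: "(x, K) \<in> D" "x \<notin> N" using that by (auto simp: p E_def)
          obtain u v where uv: "u \<le> v" "K = {u..v}" using K[OF xK(1)] by blast
          have x: "x \<in> {u..v}" "{u..v} \<subseteq> {a..b}" using tD(2,3)[OF xK(1)] uv by auto
          have "{u..v} \<subseteq> ball x (d x)"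
            using fineD[OF D(2) xK(1)] xK(2) x uv by (auto simp: \<gamma>_def)
          then have "\<bar>u - x\<bar> < d x" "\<bar>v - x\<bar> < d x"
            using uv by (auto simp: subset_iff dist_real_def abs_minus_commute)
          \<comment> \<open>The tag \<open>x\<close> lies between \<open>u\<close> and
            \<open>v\<close>, so the errors at the two endpoints,
            \<open>\<epsilon> * (v - x)\<close> and \<open>\<epsilon> * (x - u)\<close>, add up to
            \<open>\<epsilon>\<close> times the length of the interval.\<close>
          then have "\<bar>h v - h x - f x * (v - x)\<bar> \<le> \<epsilon> * (v - x)" "\<bar>h u - h x - f x * (u - x)\<bar> \<le> \<epsilon> * (x - u)"
            using d(2)[of x v] d(2)[of x u] xK x uv by auto
          then have "\<bar>f x * (v - u) - (h v - h u)\<bar> \<le> \<epsilon> * (v - u)"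
            by (simp add: algebra_simps abs_le_iff)
          then show ?thesis using uv xK by (simp add: p err_def g_def mult.commute)
        qed
        then have "(\<Sum>p\<in>D - E. \<bar>err p\<bar>) \<le> (\<Sum>p\<in>D - E. \<epsilon> * measure lborel (snd p))"
          by (rule sum_mono)
        also have "\<dots> \<le> (\<Sum>p\<in>D. \<epsilon> * measure lborel (snd p))"
          using fin \<epsilon> by (intro sum_mono2) auto
        also have "\<dots> = \<epsilon> * (b - a)"
          using additive_content_tagged_division[of D a b] D(1) \<open>a \<le> b\<close>
          by (simp add: sum_distrib_left[symmetric] case_prod_unfold)
        finally show ?thesis .
      qed
      moreover have "(\<Sum>p\<in>D. \<bar>err p\<bar>) = (\<Sum>p\<in>D - E. \<bar>err p\<bar>) + (\<Sum>p\<in>E. \<bar>err p\<bar>)"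
        using fin by (intro sum.subset_diff) (auto simp: E_def)
      moreover have "(\<Sum>(x,K)\<in>D. measure lborel K *\<^sub>R g x) - (h b - h a) = (\<Sum>p\<in>D. err p)"
        using additive_tagged_division_1[OF \<open>a \<le> b\<close> D(1), of h]
        by (simp add: err_def case_prod_unfold sum_subtractf)
      moreover have "\<bar>\<Sum>p\<in>D. err p\<bar> \<le> (\<Sum>p\<in>D. \<bar>err p\<bar>)" by (rule sum_abs)
      ultimately show ?thesis using \<epsilon> by simp
    qed
    show "\<exists>\<gamma>. gauge \<gamma> \<and> (\<forall>D. D tagged_division_of {a..b} \<and> \<gamma> fine D \<longrightarrow>
        norm ((\<Sum>(x,K)\<in>D. measure lborel K *\<^sub>R g x) - (h b - h a)) < e)"
      using gauge estimate by (intro exI[of _ \<gamma>]) simp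
  qed
  then show ?thesis
    by (rule has_integral_spike[OF \<open>negligible N\<close>, rotated]) (simp add: g_def)
qed

section \<open>Absolute continuity of the indefinite integral\<close>

text \<open>Splitting \<open>\<bar>f\<bar>\<close> into a bounded part and a tail \<open>t n\<close> of small integral.\<close>

lemma absolutely_continuous_on_integral:
  fixes f :: "real \<Rightarrow> real"
  assumes f: "f absolutely_integrable_on {a..b}"
  shows "absolutely_continuous_on {a..b} (\<lambda>x. integral {a..x} f)"
  unfolding absolutely_continuous_on_def
proof (intro allI impI)
  fix \<epsilon> :: real assume "\<epsilon> > 0"
  define t where "t n x = max (\<bar>f x\<bar> - real n) 0" for n x
  have af: "(\<lambda>x. \<bar>f x\<bar>) absolutely_integrable_on {a..b}"
    using absolutely_integrable_abs[OF f] by simp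
  have t: "t n absolutely_integrable_on {a..b}" for n
    unfolding t_def using af by (intro absolutely_integrable_max_1 set_integral_diff) auto
  \<comment> \<open>Pointwise, \<open>t n x\<close> vanishes once \<open>n\<close> exceeds
    \<open>\<bar>f x\<bar>\<close>, and \<open>\<bar>f\<bar>\<close> dominates every
    \<open>t n\<close>.\<close>
  have "(\<lambda>n. integral {a..b} (t n)) \<longlonglongrightarrow> integral {a..b} (\<lambda>x. 0)"
  proof (rule dominated_convergence(2))
    show "(\<lambda>n. t n x) \<longlonglongrightarrow> 0" for x
    proof (rule tendsto_eventually)
      obtain n0 where "\<bar>f x\<bar> < real n0" using reals_Archimedean2 by blast
      then show "\<forall>\<^sub>F n in sequentially. t n x = 0"
        unfolding eventually_sequentially t_def by (intro exI[of _ n0]) auto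
    qed
    show "t n integrable_on {a..b}" for n
      using t set_lebesgue_integral_eq_integral(1) by blast
    show "(\<lambda>x. \<bar>f x\<bar>) integrable_on {a..b}" using af set_lebesgue_integral_eq_integral(1) by blast
  qed (auto simp: t_def)
  then have "(\<lambda>n. integral {a..b} (t n)) \<longlonglongrightarrow> 0" by simp
  from order_tendstoD(2)[OF this, of "\<epsilon> / 2"] \<open>\<epsilon> > 0\<close>
  obtain n where n: "integral {a..b} (t n) < \<epsilon> / 2"
    by (auto simp: eventually_sequentially)
  \<comment> \<open>The part of \<open>\<bar>f\<bar>\<close> below height \<open>n\<close>
    contributes at most \<open>real n * \<delta>\<close>, which must not exceed
    \<open>\<epsilon> / 2\<close>; adding 1 covers \<open>n = 0\<close>.\<close>
  define \<delta> where "\<delta> = \<epsilon> / (2 * (real n + 1))"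
  have \<delta>: "\<delta> > 0" "real n * \<delta> \<le> \<epsilon> / 2"
    using \<open>\<epsilon> > 0\<close> by (auto simp: \<delta>_def field_simps)
  show "\<exists>\<delta>>0. \<forall>(m::nat) u v. (\<forall>i<m. u i \<le> v i \<and> {u i..v i} \<subseteq> {a..b}) \<and>
      disjoint_family_on (\<lambda>i. {u i<..<v i}) {..<m} \<and> (\<Sum>i<m. v i - u i) < \<delta> \<longrightarrow>
      (\<Sum>i<m. \<bar>integral {a..v i} f - integral {a..u i} f\<bar>) < \<epsilon>"
  proof (intro exI[of _ \<delta>] conjI allI impI)
    fix m :: nat and u v
    assume *: "(\<forall>i<m. u i \<le> v i \<and> {u i..v i} \<subseteq> {a..b}) \<and>
      disjoint_family_on (\<lambda>i. {u i<..<v i}) {..<m} \<and> (\<Sum>i<m. v i - u i) < \<delta>"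
    have int: "g integrable_on {c..d}" if "g absolutely_integrable_on {a..b}" "{c..d} \<subseteq> {a..b}"
      for g :: "real \<Rightarrow> real" and c d
      using absolutely_integrable_on_subinterval[OF that] set_lebesgue_integral_eq_integral(1) by blast
    have bound: "\<bar>integral {a..v i} f - integral {a..u i} f\<bar>
        \<le> integral {u i..v i} (t n) + real n * (v i - u i)" if "i < m" for i
    proof -
      have i: "u i \<le> v i" "{u i..v i} \<subseteq> {a..b}" "a \<le> u i" "v i \<le> b" using * that by auto
      have "integral {a..u i} f + integral {u i..v i} f = integral {a..v i} f"
        using i by (intro Henstock_Kurzweil_Integration.integral_combine int f) auto
      then have "\<bar>integral {a..v i} f - integral {a..u i} f\<bar> = norm (integral {u i..v i} f)" by simp
      also have "\<dots> \<le> integral {u i..v i} (\<lambda>x. t n x + real n)"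
        using i by (intro integral_norm_bound_integral int f integrable_add t) (auto simp: t_def)
      also have "\<dots> = integral {u i..v i} (t n) + real n * (v i - u i)"
        using i int[OF t] by (subst integral_add) auto
      finally show ?thesis .
    qed
    have "(\<Sum>i<m. \<bar>integral {a..v i} f - integral {a..u i} f\<bar>)
        \<le> (\<Sum>i<m. integral {u i..v i} (t n) + real n * (v i - u i))"
      using bound by (intro sum_mono) auto
    also have "\<dots> = (\<Sum>i<m. integral {u i..v i} (t n)) + real n * (\<Sum>i<m. v i - u i)"
      by (simp add: sum.distrib sum_distrib_left)
    \<comment> \<open>The tail is nonnegative, so its integrals over all the intervals together are
      at most its full integral, however the intervals lie.\<close>
    also have "(\<Sum>i<m. integral {u i..v i} (t n)) \<le> integral {a..b} (t n)"
      using * int[OF t] by (intro sum_integral_disjoint_intervals_le) (auto simp: t_def)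
    also have "real n * (\<Sum>i<m. v i - u i) \<le> real n * \<delta>"
      using * by (intro mult_left_mono) auto
    finally show "(\<Sum>i<m. \<bar>integral {a..v i} f - integral {a..u i} f\<bar>) < \<epsilon>"
      using n \<delta> by linarith
  qed (rule \<delta>)
qed

section \<open>Lebesgue differentiation on the line\<close>

text \<open>
  \<open>E \<epsilon>\<close> collects the points where the difference quotients of the indefinite integral stay
  \<open>\<epsilon>\<close>-far from \<open>f\<close>. Vitali's covering lemma selects disjoint bad intervals whose fivefold
  enlargements cover \<open>E \<epsilon>\<close>, and Henstock's lemma makes their total length small.
\<close>

lemma Lebesgue_differentiation_real:
  fixes f :: "real \<Rightarrow> real"
  assumes f: "f integrable_on {a..b}"
  shows "\<exists>N. negligible N \<and> (\<forall>x\<in>{a..b} - N.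
    ((\<lambda>x. integral {a..x} f) has_real_derivative f x) (at x within {a..b}))"
proof -
  define F where "F x = integral {a..x} f" for x
  define E where "E \<epsilon> = {x \<in> {a..b}. \<forall>d>0. \<exists>y\<in>{a..b}. \<bar>y - x\<bar> < d \<and>
    \<bar>F y - F x - f x * (y - x)\<bar> > \<epsilon> * \<bar>y - x\<bar>}" for \<epsilon>
  \<comment> \<open>Identifies the error of a difference quotient, with \<open>y\<close> on either
    side of \<open>x\<close>, with the error of one tagged interval in Henstock's lemma.\<close>
  have diff: "\<bar>\<bar>y - x\<bar> * f x - integral {min x y..max x y} f\<bar> = \<bar>F y - F x - f x * (y - x)\<bar>"
    if "x \<in> {a..b}" "y \<in> {a..b}" for x y
  proof -
    have "F (min x y) + integral {min x y..max x y} f = F (max x y)"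
      unfolding F_def using that
      by (intro Henstock_Kurzweil_Integration.integral_combine integrable_on_subinterval[OF f]) auto
    then show ?thesis
      by (auto simp: min_def max_def algebra_simps abs_if split: if_splits)
  qed
  have neg: "negligible (E \<epsilon>)" if "\<epsilon> > 0" for \<epsilon>
    unfolding negligible_outer_le
  proof (intro allI impI)
    fix e :: real assume "e > 0"
    \<comment> \<open>The factor \<open>\<epsilon>\<close> is lost in passing from errors to
      lengths, the factor 5 in enlarging the intervals.\<close>
    then have e5: "\<epsilon> * e / 5 > 0" using \<open>\<epsilon> > 0\<close> by simp
    have f': "f integrable_on cbox a b" using f by simp
    have "\<exists>\<gamma>. gauge \<gamma> \<and> (\<forall>p. p tagged_partial_division_of cbox a b \<and> \<gamma> fine p \<longrightarrow>
        (\<Sum>(x,k)\<in>p. norm (measure lborel k *\<^sub>R f x - integral k f)) < \<epsilon> * e / 5)"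
      by (rule Henstock_lemma[OF f' e5]) blast
    then obtain \<gamma> where \<gamma>: "gauge \<gamma>"
      "\<forall>p. p tagged_partial_division_of cbox a b \<and> \<gamma> fine p \<longrightarrow>
        (\<Sum>(x,k)\<in>p. norm (measure lborel k *\<^sub>R f x - integral k f)) < \<epsilon> * e / 5"
      by blast
    have "\<exists>y\<in>{a..b}. {min x y..max x y} \<subseteq> \<gamma> x \<and> \<bar>F y - F x - f x * (y - x)\<bar> > \<epsilon> * \<bar>y - x\<bar>"
      if "x \<in> E \<epsilon>" for x
    proof -
      obtain d where d: "d > 0" "ball x d \<subseteq> \<gamma> x"
        using \<gamma>(1) unfolding gauge_def by (meson open_contains_ball)
      obtain y where "y \<in> {a..b}" "\<bar>y - x\<bar> < d" "\<bar>F y - F x - f x * (y - x)\<bar> > \<epsilon> * \<bar>y - x\<bar>"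
        using \<open>x \<in> E \<epsilon>\<close> d(1) unfolding E_def by blast
      moreover have "{min x y..max x y} \<subseteq> ball x d"
        using calculation by (auto simp: dist_real_def)
      ultimately show ?thesis using d by blast
    qed
    then obtain Y where Y: "\<And>x. x \<in> E \<epsilon> \<Longrightarrow> Y x \<in> {a..b}"
      "\<And>x. x \<in> E \<epsilon> \<Longrightarrow> {min x (Y x)..max x (Y x)} \<subseteq> \<gamma> x"
      "\<And>x. x \<in> E \<epsilon> \<Longrightarrow> \<bar>F (Y x) - F x - f x * (Y x - x)\<bar> > \<epsilon> * \<bar>Y x - x\<bar>"
      by metis
    define K where "K x = {min x (Y x)..max x (Y x)}" for x
    \<comment> \<open>The covering lemma is about balls, so each interval is written with its
      midpoint as centre and half its length as radius.\<close>
    have cball: "cball ((x + Y x) / 2) (\<bar>Y x - x\<bar> / 2) = K x" for x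
      unfolding cball_eq_atLeastAtMost K_def by (auto simp: min_def max_def abs_if field_simps)
    have E_ab: "E \<epsilon> \<subseteq> {a..b}" by (auto simp: E_def)
    obtain C where C: "countable C" "C \<subseteq> E \<epsilon>"
      "pairwise (\<lambda>i j. disjnt (K i) (K j)) C"
      "E \<epsilon> \<subseteq> (\<Union>x\<in>C. cball ((x + Y x) / 2) (5 * (\<bar>Y x - x\<bar> / 2)))"
    proof (rule Vitali_covering_lemma_cballs[where S = "E \<epsilon>" and K = "E \<epsilon>"
          and a = "\<lambda>x. (x + Y x) / 2" and r = "\<lambda>x. \<bar>Y x - x\<bar> / 2" and B = "b - a"])
      show "E \<epsilon> \<subseteq> (\<Union>x\<in>E \<epsilon>. cball ((x + Y x) / 2) (\<bar>Y x - x\<bar> / 2))"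
        unfolding cball K_def by auto
      \<comment> \<open>The radius is positive because \<open>Y x = x\<close> would turn the strict
        inequality for \<open>Y x\<close> into \<open>0 > 0\<close>.\<close>
      show "0 < \<bar>Y x - x\<bar> / 2 \<and> \<bar>Y x - x\<bar> / 2 \<le> b - a" if "x \<in> E \<epsilon>" for x
        using Y(1,3)[OF that] E_ab that by (cases "Y x = x") (auto simp: subset_iff abs_if)
    qed (use cball in auto)
    define T where "T = (\<Union>x\<in>C. cball ((x + Y x) / 2) (5 * (\<bar>Y x - x\<bar> / 2)))"
    \<comment> \<open>Henstock's lemma treats finite partial divisions only. A bound uniform over
      finite \<open>D\<close> then passes to the countable union \<open>T\<close>.\<close>
    have bound: "measure lebesgue (\<Union>x\<in>D. cball ((x + Y x) / 2) (5 * (\<bar>Y x - x\<bar> / 2))) \<le> e"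
      if D: "D \<subseteq> C" "finite D" for D
    proof -
      have DE: "D \<subseteq> E \<epsilon>" using D C by auto
      define p where "p = (\<lambda>x. (x, K x)) ` D"
      have "(\<Sum>(x,k)\<in>p. norm (measure lborel k *\<^sub>R f x - integral k f)) < \<epsilon> * e / 5"
      proof (rule \<gamma>(2)[rule_format], intro conjI)
        show "p tagged_partial_division_of cbox a b"
          unfolding tagged_partial_division_of_def
        proof (intro conjI allI impI)
          show "finite p" using D by (simp add: p_def)
        next
          fix x k assume "(x, k) \<in> p"
          then have x: "x \<in> E \<epsilon>" "k = K x" using DE by (auto simp: p_def)
          then show "x \<in> k" "k \<subseteq> cbox a b" "\<exists>a b. k = cbox a b"
            using Y(1)[of x] E_ab by (auto simp: K_def)
        next
          fix x1 K1 x2 K2 assume "(x1, K1) \<in> p \<and> (x2, K2) \<in> p \<and> (x1, K1) \<noteq> (x2, K2)"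
          then have "x1 \<in> C" "x2 \<in> C" "x1 \<noteq> x2" "K1 = K x1" "K2 = K x2"
            using D by (auto simp: p_def)
          then have "disjnt K1 K2" using C(3) by (simp add: pairwise_def)
          then show "interior K1 \<inter> interior K2 = {}"
            using interior_subset by (fastforce simp: disjnt_def)
        qed
        show "\<gamma> fine p" using Y(2) DE by (auto simp: fine_def p_def K_def)
      qed
      moreover have "(\<Sum>(x,k)\<in>p. norm (measure lborel k *\<^sub>R f x - integral k f))
          = (\<Sum>x\<in>D. \<bar>measure lborel (K x) * f x - integral (K x) f\<bar>)"
        unfolding p_def by (subst sum.reindex) (auto simp: inj_on_def)
      moreover have "(\<Sum>x\<in>D. \<epsilon> * \<bar>Y x - x\<bar>) \<le> (\<Sum>x\<in>D. \<bar>measure lborel (K x) * f x - integral (K x) f\<bar>)"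
      proof (rule sum_mono)
        fix x assume "x \<in> D"
        then have x: "x \<in> E \<epsilon>" using DE by auto
        have "measure lborel (K x) = \<bar>Y x - x\<bar>" by (auto simp: K_def)
        then show "\<epsilon> * \<bar>Y x - x\<bar> \<le> \<bar>measure lborel (K x) * f x - integral (K x) f\<bar>"
          using diff[of x "Y x"] Y(1,3)[OF x] E_ab x by (auto simp: K_def)
      qed
      ultimately have "(\<Sum>x\<in>D. \<epsilon> * \<bar>Y x - x\<bar>) < \<epsilon> * e / 5" by linarith
      then have "\<epsilon> * (\<Sum>x\<in>D. 5 * \<bar>Y x - x\<bar>) < \<epsilon> * e"
        by (simp add: sum_distrib_left[symmetric] algebra_simps)
      then have "(\<Sum>x\<in>D. 5 * \<bar>Y x - x\<bar>) < e" using \<open>\<epsilon> > 0\<close> by simp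
      moreover have "measure lebesgue (\<Union>x\<in>D. cball ((x + Y x) / 2) (5 * (\<bar>Y x - x\<bar> / 2)))
          \<le> (\<Sum>x\<in>D. measure lebesgue (cball ((x + Y x) / 2) (5 * (\<bar>Y x - x\<bar> / 2))))"
        using D by (intro measure_UNION_le) auto
      moreover have "measure lebesgue (cball ((x + Y x) / 2) (5 * (\<bar>Y x - x\<bar> / 2))) = 5 * \<bar>Y x - x\<bar>" for x
        unfolding cball_eq_atLeastAtMost by simp
      ultimately show ?thesis by simp
    qed
    have "T \<in> lmeasurable"
      unfolding T_def by (rule fmeasurable_UN_bound[OF C(1) _ bound]) simp_all
    moreover have "measure lebesgue T \<le> e"
      unfolding T_def by (rule measure_UN_bound[OF C(1) _ bound]) simp_all
    ultimately show "\<exists>T. E \<epsilon> \<subseteq> T \<and> T \<in> lmeasurable \<and> measure lebesgue T \<le> e"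
      using C(4) T_def by blast
  qed
  show ?thesis
  proof (intro exI conjI ballI)
    \<comment> \<open>Countably many thresholds \<open>1 / real (Suc n)\<close> suffice: every
      positive \<epsilon> lies above one of them.\<close>
    show "negligible (\<Union>n. E (1 / real (Suc n)))"
      by (intro negligible_Union_nat neg) auto
    fix x assume x: "x \<in> {a..b} - (\<Union>n. E (1 / real (Suc n)))"
    have "\<exists>d>0. \<forall>y\<in>{a..b}. \<bar>y - x\<bar> < d \<longrightarrow> \<bar>F y - F x - f x * (y - x)\<bar> \<le> \<epsilon> * \<bar>y - x\<bar>"
      if "\<epsilon> > 0" for \<epsilon>
    proof -
      obtain n where n: "1 / real (Suc n) < \<epsilon>" using nat_approx_posE[OF \<open>\<epsilon> > 0\<close>] by blast
      have "x \<notin> E (1 / real (Suc n))" "x \<in> {a..b}" using x by auto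
      then obtain d where d: "d > 0" "\<forall>y\<in>{a..b}. \<bar>y - x\<bar> < d \<longrightarrow>
          \<bar>F y - F x - f x * (y - x)\<bar> \<le> 1 / real (Suc n) * \<bar>y - x\<bar>"
        unfolding E_def mem_Collect_eq by (meson not_less)
      have "1 / real (Suc n) * \<bar>y - x\<bar> \<le> \<epsilon> * \<bar>y - x\<bar>" for y
        using n by (intro mult_right_mono) auto
      with d show ?thesis by (meson order_trans)
    qed
    then show "((\<lambda>x. integral {a..x} f) has_real_derivative f x) (at x within {a..b})"
      unfolding F_def[symmetric] has_field_derivative_def has_derivative_within_alt
      by (auto intro: bounded_linear_mult_right)
  qed
qed


section \<open>Norm bounds, shifts and exceptional sets in elementary form\<close>

text \<open>A supremum is at most \<open>r\<close> exactly when each member is, and on subintervals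
  of \<open>X\<close> absolute integrability makes the Lebesgue integral agree with the gauge
  integral used in the calculus lemmas.\<close>

lemma discrepancy_norm_le_iff:
  assumes "f locally_integrable_on X" "0 \<le> r"
  shows "discrepancy_norm X f \<le> ennreal r \<longleftrightarrow>
    (\<forall>c d. c \<le> d \<and> {c..d} \<subseteq> X \<longrightarrow> \<bar>integral {c..d} f\<bar> \<le> r)"
proof -
  have "(LINT x:{c..d}|lebesgue. f x) = integral {c..d} f" if "{c..d} \<subseteq> X" for c d
    using that assms by (auto simp: locally_integrable_on_def set_lebesgue_integral_eq_integral)
  then show ?thesis
    unfolding discrepancy_norm_def SUP_le_iff using \<open>0 \<le> r\<close> by auto
qed

lemma uniform_norm_le_iff:
  assumes "0 \<le> r"
  shows "uniform_norm X h \<le> ennreal r \<longleftrightarrow> (\<forall>x\<in>X. \<bar>h x\<bar> \<le> r)"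
  unfolding uniform_norm_def SUP_le_iff using assms by simp

text \<open>All values of \<open>F\<close> lie between \<open>s - r\<close> and \<open>s\<close>,
  where \<open>s\<close> is the supremum of \<open>F\<close> on \<open>X\<close>. The shift
  \<open>c = r / 2 - s\<close> centres this range at 0.\<close>

lemma oscillation_le_imp_shift_bound:
  fixes F :: "'a \<Rightarrow> real"
  assumes "X \<noteq> {}" and osc: "\<And>x y. x \<in> X \<Longrightarrow> y \<in> X \<Longrightarrow> F y - F x \<le> r"
  obtains c where "\<And>x. x \<in> X \<Longrightarrow> \<bar>F x + c\<bar> \<le> r / 2"
proof
  fix x assume x: "x \<in> X"
  have "bdd_above (F ` X)"
    by (rule bdd_aboveI2[of _ _ "F x + r"]) (use osc[OF x] in fastforce)
  then have "F x \<le> (SUP y\<in>X. F y)" using x by (rule cSUP_upper2) simp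
  moreover have "(SUP y\<in>X. F y) \<le> F x + r"
    using osc[OF x] \<open>X \<noteq> {}\<close> by (intro cSUP_least) fastforce+
  ultimately show "\<bar>F x + (r / 2 - (SUP y\<in>X. F y))\<bar> \<le> r / 2" by linarith
qed

text \<open>Null sets of \<open>lebesgue\<close> are exactly the negligible sets. This links the
  almost everywhere clause of the theorem to the exceptional sets \<open>N\<close> of the calculus
  lemmas.\<close>

lemma AE_lebesgue_on_iff_negligible:
  assumes "S \<in> sets lebesgue"
  shows "(AE x in lebesgue_on S. P x) \<longleftrightarrow> (\<exists>N. negligible N \<and> (\<forall>x\<in>S - N. P x))"
proof -
  have "(AE x in lebesgue_on S. P x) \<longleftrightarrow> (AE x in lebesgue. x \<in> S \<longrightarrow> P x)"
    using assms by (intro AE_restrict_space_iff) simp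
  also have "\<dots> \<longleftrightarrow> (\<exists>N. negligible N \<and> (\<forall>x\<in>S - N. P x))"
    unfolding eventually_ae_filter negligible_iff_null_sets by (auto simp: subset_iff)
  finally show ?thesis .
qed

section \<open>Discrepancy bounds and monotone decompositions\<close>

theorem theorem3p2:
  fixes a b r :: real and f :: "real \<Rightarrow> real"
  assumes "a < b"
    and "f locally_integrable_on {a..b}"
    and "0 \<le> r"
  shows "discrepancy_norm {a..b} f \<le> ennreal r \<longleftrightarrow>
    (\<exists>h1 h2 :: real \<Rightarrow> real.
      mono_on {a..b} h1 \<and> mono_on {a..b} h2 \<and>
      locally_absolutely_continuous_on {a..b} h1 \<and>
      locally_absolutely_continuous_on {a..b} h2 \<and>
      uniform_norm {a..b} (\<lambda>x. h2 x - h1 x) \<le> ennreal (r / 2) \<and>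
      (AE x in lebesgue_on {a..b}. \<exists>D1 D2.
        (h1 has_real_derivative D1) (at x within {a..b}) \<and>
        (h2 has_real_derivative D2) (at x within {a..b}) \<and>
        f x = D2 - D1))" (is "?L \<longleftrightarrow> ?R")
proof
  assume ?L
  then have D: "\<bar>integral {c..d} f\<bar> \<le> r" if "c \<le> d" "{c..d} \<subseteq> {a..b}" for c d
    using that assms(3) by (simp add: discrepancy_norm_le_iff[OF assms(2)])
  have f: "f absolutely_integrable_on {a..b}"
    using assms(2) by (simp add: locally_integrable_on_def)
  moreover define fp fm where "fp x = max (f x) 0" and "fm x = max (- f x) 0" for x
  moreover have "(\<lambda>x. - f x) absolutely_integrable_on {a..b}"
    using f by (simp add: set_integrable_def)
  ultimately have fpm: "fp absolutely_integrable_on {a..b}" "fm absolutely_integrable_on {a..b}"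
    unfolding fp_def fm_def by (auto intro!: absolutely_integrable_max_1)
  have int: "g integrable_on {c..d}" if "g absolutely_integrable_on {a..b}" "{c..d} \<subseteq> {a..b}"
    for g :: "real \<Rightarrow> real" and c d
    using absolutely_integrable_on_subinterval[OF that] set_lebesgue_integral_eq_integral(1) by blast
  have mono: "mono_on {a..b} (\<lambda>x. integral {a..x} g + c)"
    if "g absolutely_integrable_on {a..b}" "\<And>x. 0 \<le> g x" for g :: "real \<Rightarrow> real" and c
    using that by (intro mono_onI add_right_mono integral_subset_le int) auto
  have lac: "locally_absolutely_continuous_on {a..b} (\<lambda>x. integral {a..x} g + c)"
    if "g absolutely_integrable_on {a..b}" for g c
    using absolutely_continuous_on_subset[OF absolutely_continuous_on_integral[OF that]]
    by (simp add: locally_absolutely_continuous_on_def absolutely_continuous_on_add_const_iff)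
  define F where "F x = integral {a..x} f" for x
  have "F y - F x \<le> r" if "x \<in> {a..b}" "y \<in> {a..b}" for x y
  proof -
    \<comment> \<open>Ordering the points by \<open>min\<close> and \<open>max\<close> gives an
      integral over a genuine interval, whichever of \<open>x\<close> and \<open>y\<close> is
      larger.\<close>
    have "F (min x y) + integral {min x y..max x y} f = F (max x y)"
      unfolding F_def using that
      by (intro Henstock_Kurzweil_Integration.integral_combine int[OF f]) auto
    moreover have "\<bar>integral {min x y..max x y} f\<bar> \<le> r" using that by (intro D) auto
    ultimately show ?thesis by (auto simp: min_def max_def abs_le_iff split: if_splits)
  qed
  then obtain c where c: "\<And>x. x \<in> {a..b} \<Longrightarrow> \<bar>F x + c\<bar> \<le> r / 2"
    using oscillation_le_imp_shift_bound[of "{a..b}" F r] \<open>a < b\<close> by auto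
  \<comment> \<open>The summand \<open>+ 0\<close> gives \<open>h1\<close> the same shape as
    \<open>h2\<close>, so \<open>mono\<close> and \<open>lac\<close> apply to both. The shift sits
    in \<open>h2\<close> alone, whence \<open>h2 - h1\<close> is \<open>F + c\<close>.\<close>
  define h1 h2 where "h1 x = integral {a..x} fm + 0" and "h2 x = integral {a..x} fp + c" for x
  have "h2 x - h1 x = F x + c" if "x \<in> {a..b}" for x
  proof -
    have "integral {a..x} fp - integral {a..x} fm = integral {a..x} (\<lambda>x. fp x - fm x)"
      using that by (intro integral_diff[symmetric] int fpm) auto
    also have "(\<lambda>x. fp x - fm x) = f" by (auto simp: fp_def fm_def)
    finally show ?thesis by (simp add: h1_def h2_def F_def)
  qed
  then have "uniform_norm {a..b} (\<lambda>x. h2 x - h1 x) \<le> ennreal (r / 2)"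
    using c \<open>0 \<le> r\<close> by (simp add: uniform_norm_le_iff)
  moreover have "mono_on {a..b} h1" "mono_on {a..b} h2"
    "locally_absolutely_continuous_on {a..b} h1" "locally_absolutely_continuous_on {a..b} h2"
    unfolding h1_def h2_def by (intro mono lac fpm; simp add: fp_def fm_def)+
  moreover have "AE x in lebesgue_on {a..b}. \<exists>D1 D2.
        (h1 has_real_derivative D1) (at x within {a..b}) \<and>
        (h2 has_real_derivative D2) (at x within {a..b}) \<and> f x = D2 - D1"
  proof -
    obtain N1 where N1: "negligible N1" "\<forall>x\<in>{a..b} - N1.
        ((\<lambda>x. integral {a..x} fm) has_real_derivative fm x) (at x within {a..b})"
      using Lebesgue_differentiation_real[OF int[OF fpm(2) order_refl]]
      by (elim exE conjE) (rule that)
    obtain N2 where N2: "negligible N2" "\<forall>x\<in>{a..b} - N2.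
        ((\<lambda>x. integral {a..x} fp) has_real_derivative fp x) (at x within {a..b})"
      using Lebesgue_differentiation_real[OF int[OF fpm(1) order_refl]]
      by (elim exE conjE) (rule that)
    have "\<exists>D1 D2. (h1 has_real_derivative D1) (at x within {a..b}) \<and>
        (h2 has_real_derivative D2) (at x within {a..b}) \<and> f x = D2 - D1"
      if "x \<in> {a..b} - (N1 \<union> N2)" for x
    proof (intro exI conjI)
      show "(h1 has_real_derivative fm x) (at x within {a..b})"
        using DERIV_add[OF N1(2)[rule_format] DERIV_const, of x 0] that by (simp add: h1_def[abs_def])
      show "(h2 has_real_derivative fp x) (at x within {a..b})"
        using DERIV_add[OF N2(2)[rule_format] DERIV_const, of x c] that by (simp add: h2_def[abs_def])
      show "f x = fp x - fm x" by (simp add: fp_def fm_def)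
    qed
    then show ?thesis
      using negligible_Un[OF N1(1) N2(1)]
      by (subst AE_lebesgue_on_iff_negligible, simp) (intro exI[of _ "N1 \<union> N2"] conjI ballI)
  qed
  ultimately show ?R by blast
next
  assume ?R
  then obtain h1 h2 where
    lac: "locally_absolutely_continuous_on {a..b} h1" "locally_absolutely_continuous_on {a..b} h2"
    and un: "uniform_norm {a..b} (\<lambda>x. h2 x - h1 x) \<le> ennreal (r / 2)"
    and ae: "AE x in lebesgue_on {a..b}. \<exists>D1 D2.
        (h1 has_real_derivative D1) (at x within {a..b}) \<and>
        (h2 has_real_derivative D2) (at x within {a..b}) \<and> f x = D2 - D1"
    by blast
  define h where "h x = h2 x - h1 x" for x
  have h: "\<bar>h x\<bar> \<le> r / 2" if "x \<in> {a..b}" for x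
    using un that \<open>0 \<le> r\<close> by (simp add: uniform_norm_le_iff h_def)
  obtain N where N: "negligible N" "\<And>x. x \<in> {a..b} - N \<Longrightarrow> \<exists>D1 D2.
        (h1 has_real_derivative D1) (at x within {a..b}) \<and>
        (h2 has_real_derivative D2) (at x within {a..b}) \<and> f x = D2 - D1"
    using ae by (subst (asm) AE_lebesgue_on_iff_negligible) auto
  have der: "(h has_real_derivative f x) (at x within {a..b})" if "x \<in> {a..b} - N" for x
    using N(2)[OF that] unfolding h_def[abs_def] by (auto intro: DERIV_diff)
  have "\<bar>integral {c..d} f\<bar> \<le> r" if cd: "c \<le> d" "{c..d} \<subseteq> {a..b}" for c d
  proof -
    \<comment> \<open>The derivative within \<open>{a..b}\<close> restricts to
      \<open>{c..d}\<close>, and the same \<open>N\<close> serves every subinterval. The two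
      endpoint bounds \<open>r / 2\<close> then add up to \<open>r\<close>.\<close>
    have "(f has_integral h d - h c) {c..d}"
    proof (rule fundamental_theorem_of_calculus_absolutely_continuous[OF cd(1) _ N(1)])
      show "absolutely_continuous_on {c..d} h"
        unfolding h_def[abs_def] using lac cd(2)
        by (intro absolutely_continuous_on_diff) (auto simp: locally_absolutely_continuous_on_def)
      show "(h has_real_derivative f x) (at x within {c..d})" if "x \<in> {c..d} - N" for x
        using der[of x] cd(2) that by (auto intro: DERIV_subset)
    qed
    then have "integral {c..d} f = h d - h c" by (rule integral_unique)
    moreover have "\<bar>h c\<bar> \<le> r / 2" "\<bar>h d\<bar> \<le> r / 2" using cd h[of c] h[of d] by auto
    ultimately show ?thesis by linarith
  qed
  then show ?L by (simp add: discrepancy_norm_le_iff[OF assms(2,3)])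
qed

end
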